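(* Let $\omega=e^{2\pi i/3}$ and let $$A=\begin{pmatrix}0&0&0&0&0&0\\0&0&1&1&2&2\\0&1&0&2&2&1\\0&1&2&0&1&2\\0&2&2&1&0&1\\0&2&1&2&1&0\end{pmatrix}$$ with entries in $\mathbb{Z}/3\mathbb{Z}$ and rows and columns indexed by $0,\dots,5$. Let $H$ be the $6\times 6$ complex matrix with entries $H_{rs}=\omega^{A_{rs}}$, let $h_0,\dots,h_5\in\mathbb{C}^6$ be its columns, and let $\Phi_{21}$ be the $6\times 6$ array of vectors with $(i,j)$ entry $\frac{1}{\sqrt6}(h_i\odot h_j)\in\mathbb{C}^6$, $0\le i,j\le 5$. Then $\Phi_{21}$ is a quantum Latin square of order $6$ and its cardinality is $21$.
   Context: For $x,y\in\mathbb{C}^n$, $x\odot y=(x_0y_0,\dots,x_{n-1}y_{n-1})^{\mathsf T}$ is the entrywise (Schur) product. A quantum Latin square of order $n$, denoted $\mathrm{QLS}(n)$, is an $n\times n$ array $(\phi_{ij})_{0\le i,j\le n-1}$ of unit vectors in $\mathbb{C}^n$ such that every row and every column forms an orthonormal basis of $\mathbb{C}^n$. Two unit vectors $u,v$ are phase equivalent, $u\sim v$, if $u=e^{i\alpha}v$ for some $\alpha\in\mathbb{R}$. The cardinality of a quantum Latin square is the number of distinct phase-equivalence classes among its $n^2$ entries. *)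

theory Defs
  imports Complex_Main "Jordan_Normal_Form.VS_Connect"
begin

definition schur_prod :: "'a :: times vec \<Rightarrow> 'a vec \<Rightarrow> 'a vec" where
  "schur_prod x y = vec (dim_vec x) (\<lambda>i. x $ i * y $ i)"

definition unit_vectors :: "nat \<Rightarrow> complex vec set" where
  "unit_vectors n = {v \<in> carrier_vec n. v \<bullet>c v = 1}"

(* A family b 0, ..., b (n - 1), not merely a set: entries with different indices must be
   orthogonal, so repetitions are excluded. *)
definition orthonormal_basis :: "nat \<Rightarrow> (nat \<Rightarrow> complex vec) \<Rightarrow> bool" where
  "orthonormal_basis n b \<longleftrightarrow>
     (\<forall>i<n. b i \<in> unit_vectors n) \<and>
     (\<forall>i<n. \<forall>j<n. i \<noteq> j \<longrightarrow> b i \<bullet>c b j = 0) \<and>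
     vectorspace.basis class_ring (module_vec TYPE(complex) n) (b ` {..<n})"

(* Only the values phi i j with i, j < n are relevant. *)
definition quantum_latin_square :: "nat \<Rightarrow> (nat \<Rightarrow> nat \<Rightarrow> complex vec) \<Rightarrow> bool" where
  "quantum_latin_square n \<phi> \<longleftrightarrow>
     (\<forall>i<n. \<forall>j<n. \<phi> i j \<in> unit_vectors n) \<and>
     (\<forall>i<n. orthonormal_basis n (\<lambda>j. \<phi> i j)) \<and>
     (\<forall>j<n. orthonormal_basis n (\<lambda>i. \<phi> i j))"

definition phase_equiv :: "complex vec \<Rightarrow> complex vec \<Rightarrow> bool" where
  "phase_equiv u v \<longleftrightarrow> (\<exists>\<alpha>::real. u = exp (\<i> * complex_of_real \<alpha>) \<cdot>\<^sub>v v)"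

definition phase_rel :: "nat \<Rightarrow> (complex vec \<times> complex vec) set" where
  "phase_rel n = {(u, v). u \<in> unit_vectors n \<and> v \<in> unit_vectors n \<and> phase_equiv u v}"

lemma equiv_phase_rel: "equiv (unit_vectors n) (phase_rel n)"
proof (rule equivI)
  show "phase_rel n \<subseteq> unit_vectors n \<times> unit_vectors n"
    by (auto simp: phase_rel_def)
  have "phase_equiv u u" for u
    unfolding phase_equiv_def by (rule exI[of _ 0]) auto
  then show "refl_on (unit_vectors n) (phase_rel n)"
    by (auto simp: refl_on_def phase_rel_def)
  have "phase_equiv v u" if "phase_equiv u v" for u v
  proof -
    from that obtain a :: real where u: "u = exp (\<i> * complex_of_real a) \<cdot>\<^sub>v v"
      unfolding phase_equiv_def by blast
    have "v = exp (\<i> * complex_of_real (- a)) \<cdot>\<^sub>v u"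
      unfolding u smult_smult_assoc exp_add[symmetric] by auto
    then show ?thesis unfolding phase_equiv_def by blast
  qed
  then show "sym (phase_rel n)"
    by (auto simp: sym_def phase_rel_def)
  have "phase_equiv u w" if "phase_equiv u v" "phase_equiv v w" for u v w
  proof -
    from that obtain a b :: real
      where u: "u = exp (\<i> * complex_of_real a) \<cdot>\<^sub>v v"
        and v: "v = exp (\<i> * complex_of_real b) \<cdot>\<^sub>v w"
      unfolding phase_equiv_def by blast
    have "u = exp (\<i> * complex_of_real (a + b)) \<cdot>\<^sub>v w"
      unfolding u v smult_smult_assoc exp_add[symmetric] by (simp add: distrib_left)
    then show ?thesis unfolding phase_equiv_def by blast
  qed
  then show "trans (phase_rel n)"
    unfolding trans_def phase_rel_def by blast
qed

(* The quotient consists of the classes of phase_rel n that contain an entry of the array. *)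
definition qls_cardinality :: "nat \<Rightarrow> (nat \<Rightarrow> nat \<Rightarrow> complex vec) \<Rightarrow> nat" where
  "qls_cardinality n \<phi> = card ({\<phi> i j | i j. i < n \<and> j < n} // phase_rel n)"

definition omega :: complex where
  "omega = exp (2 * complex_of_real pi * \<i> / 3)"

(* The entries, elements of Z/3Z, are given by their representatives in {0, 1, 2};
   omega ^ a depends only on a mod 3. *)
definition A_mat :: "nat mat" where
  "A_mat = mat_of_rows_list 6
     [[0,0,0,0,0,0],
      [0,0,1,1,2,2],
      [0,1,0,2,2,1],
      [0,1,2,0,1,2],
      [0,2,2,1,0,1],
      [0,2,1,2,1,0]]"

definition H_mat :: "complex mat" where
  "H_mat = map_mat (\<lambda>a. omega ^ a) A_mat"

definition Phi21 :: "nat \<Rightarrow> nat \<Rightarrow> complex vec" where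
  "Phi21 i j = complex_of_real (1 / sqrt 6) \<cdot>\<^sub>v schur_prod (col H_mat i) (col H_mat j)"

end

theory Submission
  imports Defs
begin

text \<open>
  The matrix \<open>H\<close> is a complex Hadamard matrix with entries in the cube roots of unity.
  Since its entries are unimodular, multiplying two columns entrywise by \<open>h i\<close> does not change
  their inner product, so each row of the array is the orthonormal basis \<open>h j / sqrt 6\<close> up to a
  diagonal unitary. The array is symmetric, so the same holds for its columns.
  All entries have first coordinate \<open>1 / sqrt 6\<close>, so phase equivalent entries are equal, and the
  cardinality is the number of distinct exponent vectors \<open>A i + A j\<close> modulo 3.
\<close>

section \<open>Orthonormal bases and quantum Latin squares from Gram relations\<close>

lemma orthonormal_basisI:
  assumes unit: "\<And>i. i < n \<Longrightarrow> b i \<in> unit_vectors n"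
    and orth: "\<And>i j. i < n \<Longrightarrow> j < n \<Longrightarrow> i \<noteq> j \<Longrightarrow> b i \<bullet>c b j = 0"
  shows "orthonormal_basis n b"
proof -
  interpret vec_space "TYPE(complex)" n .
  have carrier: "b i \<in> carrier_vec n" and norm: "b i \<bullet>c b i = 1" if "i < n" for i
    using unit[OF that] by (auto simp: unit_vectors_def)
  define M where "M = mat_of_rows n (map b [0..<n])"
  have M: "M \<in> carrier_mat n n"
    by (simp add: M_def mat_of_rows_def)
  have row_M: "row M i = b i" if "i < n" for i
    using that carrier by (simp add: M_def)
  \<comment> \<open>The entries of this product are the inner products of the family. Since it is
    the identity, \<open>det M\<close> cannot vanish, which makes the rows independent.\<close>
  have "M * transpose_mat (map_mat cnj M) = 1\<^sub>m n"
  proof (rule eq_matI)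
    fix i j assume "i < dim_row (1\<^sub>m n :: complex mat)" "j < dim_col (1\<^sub>m n :: complex mat)"
    then have ij: "i < n" "j < n" by auto
    have "col (transpose_mat (map_mat cnj M)) j = conjugate (b j)"
      using ij M row_M[OF ij(2)] carrier[OF ij(2)] by (auto simp flip: row_M)
    then show "(M * transpose_mat (map_mat cnj M)) $$ (i, j) = 1\<^sub>m n $$ (i, j)"
      using ij M row_M norm orth by auto
  qed (use M in auto)
  then have "det M * det (transpose_mat (map_mat cnj M)) = 1"
    using M by (metis det_mult det_one map_carrier_mat transpose_carrier_mat)
  then have "lin_indpt (set (rows M))"
    using det_not_0_imp_lin_indpt_rows[OF M] by (metis mult_zero_left zero_neq_one)
  moreover have "set (rows M) = b ` {..<n}"
    using M row_M by (auto simp: rows_def)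
  \<comment> \<open>Without repetitions the family has as many members as the dimension, so
    independence suffices for a basis.\<close>
  moreover have "inj_on b {..<n}"
  proof (rule inj_onI, rule ccontr)
    fix i j assume "i \<in> {..<n}" "j \<in> {..<n}" "b i = b j" "i \<noteq> j"
    then show False using orth[of i j] norm[of i] by auto
  qed
  ultimately have "basis (b ` {..<n})"
    using carrier by (intro dim_li_is_basis) (auto simp: dim_is_n card_image)
  then show ?thesis
    using unit orth by (simp add: orthonormal_basis_def)
qed

text \<open>Symmetry identifies column \<open>j\<close> with row \<open>j\<close>, so the Gram
  relations of the rows serve for the columns too.\<close>

lemma quantum_latin_square_symI:
  assumes gram: "\<And>i j k. i < n \<Longrightarrow> j < n \<Longrightarrow> k < n \<Longrightarrow> \<phi> i j \<bullet>c \<phi> i k = (if j = k then 1 else 0)"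
    and sym: "\<And>i j. i < n \<Longrightarrow> j < n \<Longrightarrow> \<phi> i j = \<phi> j i"
    and carrier: "\<And>i j. i < n \<Longrightarrow> j < n \<Longrightarrow> \<phi> i j \<in> carrier_vec n"
  shows "quantum_latin_square n \<phi>"
proof -
  have unit: "\<phi> i j \<in> unit_vectors n" if "i < n" "j < n" for i j
    using that gram carrier by (simp add: unit_vectors_def)
  moreover have "orthonormal_basis n (\<lambda>j. \<phi> i j)" if "i < n" for i
    using that unit gram by (intro orthonormal_basisI) auto
  moreover have "orthonormal_basis n (\<lambda>i. \<phi> i j)" if "j < n" for j
  proof (rule orthonormal_basisI)
    fix i k assume "i < n" "k < n" "i \<noteq> k"
    then show "\<phi> i j \<bullet>c \<phi> k j = 0"
      using that gram[of j i k] sym[of i j] sym[of k j] by simp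
  qed (use that unit in auto)
  ultimately show ?thesis
    by (simp add: quantum_latin_square_def)
qed

section \<open>Counting phase classes\<close>

lemma phase_equiv_eq:
  assumes "phase_equiv u v" "k < dim_vec v" "u $ k = v $ k" "v $ k \<noteq> 0"
  shows "u = v"
proof -
  obtain \<alpha> :: real where u: "u = exp (\<i> * complex_of_real \<alpha>) \<cdot>\<^sub>v v"
    using assms(1) by (auto simp: phase_equiv_def)
  \<comment> \<open>Comparing coordinate \<open>k\<close> and cancelling its nonzero value isolates
    the phase.\<close>
  then have "exp (\<i> * complex_of_real \<alpha>) = 1"
    using assms(2-4) by simp
  then show ?thesis by (simp add: u)
qed

text \<open>A shared nonzero coordinate pins the phase, so no class contains two members of
  \<open>S\<close>: counting classes becomes counting vectors.\<close>

lemma card_quotient_phase_rel: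
  assumes S: "S \<subseteq> unit_vectors n"
    and k: "k < n" and c: "c \<noteq> 0" and coord: "\<And>v. v \<in> S \<Longrightarrow> v $ k = c"
  shows "card (S // phase_rel n) = card S"
proof -
  have "inj_on (\<lambda>v. phase_rel n `` {v}) S"
  proof (rule inj_onI)
    fix u v assume uv: "u \<in> S" "v \<in> S" "phase_rel n `` {u} = phase_rel n `` {v}"
    then have "phase_equiv u v"
      using S eq_equiv_class[OF uv(3) equiv_phase_rel] by (auto simp: phase_rel_def)
    moreover have "dim_vec v = n"
      using S uv(2) by (auto simp: unit_vectors_def)
    ultimately show "u = v"
      using uv k c coord by (intro phase_equiv_eq[of u v k]) auto
  qed
  moreover have "S // phase_rel n = (\<lambda>v. phase_rel n `` {v}) ` S"
    by (auto simp: quotient_def)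
  ultimately show ?thesis by (simp add: card_image)
qed

section \<open>Arithmetic of the primitive cube root of unity\<close>

lemma omega_eq: "omega = Complex (- 1 / 2) (sqrt 3 / 2)"
proof -
  have "omega = cis (2 * pi / 3)"
    by (simp add: omega_def cis_conv_exp mult_ac)
  \<comment> \<open>The angle is the supplement of \<open>pi / 3\<close>.\<close>
  moreover have "cos (2 * pi / 3) = - 1 / 2" "sin (2 * pi / 3) = sqrt 3 / 2"
    using cos_pi_minus[of "pi / 3"] sin_pi_minus[of "pi / 3"] by (simp_all add: cos_60 sin_60)
  ultimately show ?thesis
    by (simp add: complex_eq_iff)
qed

lemma cnj_omega: "cnj omega = omega ^ 2"
  by (simp add: omega_eq complex_eq_iff power2_eq_square)

lemma omega_squared: "omega ^ 2 = - 1 - omega"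
  by (simp add: omega_eq complex_eq_iff power2_eq_square)

lemma omega_cubed: "omega ^ 3 = 1"
proof -
  have "omega ^ 3 = omega * (- 1 - omega)"
    by (simp add: power3_eq_cube flip: omega_squared power2_eq_square)
  also have "\<dots> = - omega - omega ^ 2"
    by (simp add: algebra_simps power2_eq_square)
  finally show ?thesis by (simp add: omega_squared)
qed

lemma omega_power_mod: "omega ^ (a mod 3) = omega ^ a"
proof -
  have "omega ^ a = omega ^ (3 * (a div 3) + a mod 3)" by simp
  also have "\<dots> = omega ^ (a mod 3)"
    unfolding power_add power_mult omega_cubed by simp
  finally show ?thesis by simp
qed

lemma omega_power_mult_cnj: "omega ^ a * cnj (omega ^ a) = 1"
proof -
  have "omega * cnj omega = 1"
    using omega_cubed by (simp add: cnj_omega power2_eq_square power3_eq_cube mult.assoc)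
  then show ?thesis
    by (simp flip: power_mult_distrib)
qed

lemma omega_power_inject:
  assumes "a < 3" "b < 3"
  shows "omega ^ a = omega ^ b \<longleftrightarrow> a = b"
  using assms
  by (auto simp: less_Suc_eq numeral_3_eq_3 omega_squared[unfolded numeral_2_eq_2] omega_eq complex_eq_iff)

section \<open>Exponent vectors and the Gram matrix of the array\<close>

definition A_rows :: "nat list list" where
  "A_rows =
     [[0,0,0,0,0,0],
      [0,0,1,1,2,2],
      [0,1,0,2,2,1],
      [0,1,2,0,1,2],
      [0,2,2,1,0,1],
      [0,2,1,2,1,0]]"

text \<open>Reducing modulo 3 gives canonical representatives, so that equality of array entries
  becomes equality of lists, which can be evaluated.\<close>

definition exponents :: "nat \<Rightarrow> nat \<Rightarrow> nat list" where
  "exponents i j = map (\<lambda>r. (A_rows ! r ! i + A_rows ! r ! j) mod 3) [0..<6]"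

lemma exponents_commute: "exponents i j = exponents j i"
  unfolding exponents_def by (subst add.commute) (rule refl)

definition omega_vec :: "nat list \<Rightarrow> complex vec" where
  "omega_vec e = vec (length e) (\<lambda>r. omega ^ (e ! r) / complex_of_real (sqrt 6))"

lemma Phi21_eq:
  assumes "i < 6" "j < 6"
  shows "Phi21 i j = omega_vec (exponents i j)"
proof -
  have A: "A_mat = mat_of_rows_list 6 A_rows"
    by (simp add: A_mat_def A_rows_def)
  have "length A_rows = 6" by (simp add: A_rows_def)
  then show ?thesis
    using assms
    by (intro eq_vecI)
      (auto simp: Phi21_def schur_prod_def H_mat_def A mat_of_rows_list_def omega_vec_def
        exponents_def power_add omega_power_mod)
qed

lemma index_Phi21:
  assumes "i < 6" "j < 6" "r < 6"
  shows "Phi21 i j $ r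
    = omega ^ (A_rows ! r ! i) * omega ^ (A_rows ! r ! j) / complex_of_real (sqrt 6)"
  using assms by (simp add: Phi21_eq omega_vec_def exponents_def omega_power_mod power_add)

lemma Phi21_carrier: "i < 6 \<Longrightarrow> j < 6 \<Longrightarrow> Phi21 i j \<in> carrier_vec 6"
  by (rule carrier_vecI) (simp add: Phi21_eq omega_vec_def exponents_def)

lemma Phi21_commute: "i < 6 \<Longrightarrow> j < 6 \<Longrightarrow> Phi21 i j = Phi21 j i"
  by (simp only: Phi21_eq exponents_commute)

text \<open>Modulo 3 the factor 2 acts as -1, so these are the exponent differences of two columns.
  That each residue occurs equally often for distinct columns is the Hadamard property of
  \<open>H_mat\<close> in combinatorial form; all 36 pairs are evaluated.\<close>

lemma A_rows_balanced:
  "\<forall>j\<in>set [0..<6]. \<forall>k\<in>set [0..<6].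
     sort (map (\<lambda>r. (A_rows ! r ! j + 2 * A_rows ! r ! k) mod 3) [0..<6])
     = (if j = k then [0, 0, 0, 0, 0, 0] else [0, 0, 1, 1, 2, 2])"
  by code_simp

lemma A_rows_gram:
  assumes "j < 6" "k < 6"
  shows "(\<Sum>r<6. omega ^ (A_rows ! r ! j) * cnj (omega ^ (A_rows ! r ! k))) = (if j = k then 6 else 0)"
proof -
  define l where "l = map (\<lambda>r. (A_rows ! r ! j + 2 * A_rows ! r ! k) mod 3) [0..<6]"
  \<comment> \<open>Conjugation squares \<open>omega\<close>, hence doubles the exponent.\<close>
  have "(\<Sum>r<6. omega ^ (A_rows ! r ! j) * cnj (omega ^ (A_rows ! r ! k)))
      = (\<Sum>r<6. omega ^ ((A_rows ! r ! j + 2 * A_rows ! r ! k) mod 3))"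
    by (simp add: omega_power_mod power_add power_mult cnj_omega)
  also have "\<dots> = sum_list (map (power omega) l)"
    by (simp add: l_def o_def lessThan_atLeast0 interv_sum_list_conv_sum_set_nat)
  \<comment> \<open>The sum depends only on the multiset of exponents, so sorting leaves just two
    cases.\<close>
  also have "\<dots> = sum_list (map (power omega) (sort l))"
    by (metis mset_map mset_sort sum_mset_sum_list)
  also have "sort l = (if j = k then [0, 0, 0, 0, 0, 0] else [0, 0, 1, 1, 2, 2])"
    using A_rows_balanced assms by (simp add: l_def)
  \<comment> \<open>Off the diagonal the sum is \<open>2 * (1 + omega + omega ^ 2)\<close>, which
    vanishes.\<close>
  finally show ?thesis
    by (simp add: omega_squared split: if_splits)
qed

lemma Phi21_gram:
  assumes "i < 6" "j < 6" "k < 6"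
  shows "Phi21 i j \<bullet>c Phi21 i k = (if j = k then 1 else 0)"
proof -
  have coord: "Phi21 i j $ r * cnj (Phi21 i k $ r)
      = omega ^ (A_rows ! r ! j) * cnj (omega ^ (A_rows ! r ! k)) / 6" (is "?l = ?r") if "r < 6" for r
  proof -
    have s: "complex_of_real (sqrt 6) * complex_of_real (sqrt 6) = 6"
      by (simp flip: of_real_mult)
    \<comment> \<open>Column \<open>i\<close> enters only through a unimodular number times its
      conjugate, so it cancels.\<close>
    have "?l = (omega ^ (A_rows ! r ! i) * cnj (omega ^ (A_rows ! r ! i)))
        * (omega ^ (A_rows ! r ! j) * cnj (omega ^ (A_rows ! r ! k)))
        / (complex_of_real (sqrt 6) * complex_of_real (sqrt 6))"
      using assms that by (simp add: index_Phi21)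
    then show ?thesis unfolding omega_power_mult_cnj s by simp
  qed
  have "Phi21 i j \<bullet>c Phi21 i k = (\<Sum>r<6. Phi21 i j $ r * cnj (Phi21 i k $ r))"
    using assms carrier_vecD[OF Phi21_carrier[of i k]]
    by (simp add: scalar_prod_def lessThan_atLeast0)
  also have "\<dots> = (\<Sum>r<6. omega ^ (A_rows ! r ! j) * cnj (omega ^ (A_rows ! r ! k)) / 6)"
    by (rule sum.cong) (simp_all only: coord lessThan_iff)
  also have "\<dots> = (if j = k then 6 else 0) / 6"
    by (simp only: A_rows_gram[OF assms(2,3)] flip: sum_divide_distrib)
  finally show ?thesis by (cases "j = k") simp_all
qed

section \<open>The number of distinct entries\<close>

lemma inj_on_omega_vec: "inj_on omega_vec {e. length e = m \<and> set e \<subseteq> {..<3}}"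
proof (rule inj_onI)
  fix d e assume de: "d \<in> {e. length e = m \<and> set e \<subseteq> {..<3}}"
    "e \<in> {e. length e = m \<and> set e \<subseteq> {..<3}}" "omega_vec d = omega_vec e"
  show "d = e"
  proof (rule nth_equalityI)
    fix r assume r: "r < length d"
    have r': "r < length e"
      using de(1,2) r by simp
    have "omega_vec d $ r = omega_vec e $ r"
      by (simp only: de(3))
    then have "omega ^ (d ! r) = omega ^ (e ! r)"
      unfolding omega_vec_def index_vec[OF r] index_vec[OF r'] by simp
    moreover have "d ! r \<in> {..<3}" "e ! r \<in> {..<3}"
      using de(1,2) nth_mem[OF r] nth_mem[OF r'] by blast+
    ultimately show "d ! r = e ! r" by (simp add: omega_power_inject)
  qed (use de in simp)
qed

text \<open>There are 6 * 7 / 2 = 21 unordered index pairs, diagonal included, so the symmetry in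
  \<open>i\<close> and \<open>j\<close> is the only source of coincidences.\<close>

lemma card_exponents: "card (set (map (\<lambda>(i, j). exponents i j) (List.product [0..<6] [0..<6]))) = 21"
  unfolding length_remdups_card_conv[symmetric] by code_simp

lemma card_Phi21: "card {Phi21 i j | i j. i < 6 \<and> j < 6} = 21"
proof -
  let ?P = "set (List.product [0..<6] [0..<6])"
  define E where "E = (\<lambda>(i, j). exponents i j) ` ?P"
  have "{Phi21 i j | i j. i < 6 \<and> j < 6} = (\<lambda>(i, j). Phi21 i j) ` ?P"
  proof (intro equalityI subsetI)
    fix v assume "v \<in> {Phi21 i j | i j. i < 6 \<and> j < 6}"
    then obtain i j where "v = Phi21 i j" "i < 6" "j < 6" by blast
    then show "v \<in> (\<lambda>(i, j). Phi21 i j) ` ?P"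
      by (intro image_eqI[of _ _ "(i, j)"]) simp_all
  qed (clarsimp, blast)
  also have "\<dots> = omega_vec ` E"
    unfolding E_def image_image by (rule image_cong) (auto simp: Phi21_eq)
  finally have "{Phi21 i j | i j. i < 6 \<and> j < 6} = omega_vec ` E" .
  moreover have "E \<subseteq> {e. length e = 6 \<and> set e \<subseteq> {..<3}}"
    by (auto simp: E_def exponents_def)
  then have "inj_on omega_vec E"
    using inj_on_omega_vec by (rule inj_on_subset[rotated])
  moreover have "card E = 21"
    using card_exponents by (simp only: E_def set_map)
  ultimately show ?thesis
    by (simp only: card_image)
qed

theorem theorem2:
  shows "quantum_latin_square 6 Phi21 \<and> qls_cardinality 6 Phi21 = 21"
proof
  show qls: "quantum_latin_square 6 Phi21"
    by (rule quantum_latin_square_symI) (simp_all add: Phi21_gram Phi21_commute Phi21_carrier)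
  let ?S = "{Phi21 i j | i j. i < 6 \<and> j < 6}"
  have "card (?S // phase_rel 6) = card ?S"
  proof (rule card_quotient_phase_rel)
    show "?S \<subseteq> unit_vectors 6"
      using qls by (auto simp: quantum_latin_square_def)
    \<comment> \<open>The zero first row of the exponent matrix supplies the common nonzero
      coordinate.\<close>
    have "A_rows ! 0 ! i = 0" if "i < 6" for i
      using that by (auto simp: A_rows_def less_Suc_eq eval_nat_numeral)
    then show "v $ 0 = 1 / complex_of_real (sqrt 6)" if "v \<in> ?S" for v
      using that by (auto simp: index_Phi21)
  qed simp_all
  then show "qls_cardinality 6 Phi21 = 21"
    by (simp only: qls_cardinality_def card_Phi21)
qed

end
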